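(* Let $(X,d)$ be a (possibly non-reversible) metric space satisfying assumptions (I), (II) and (III) of the context, with fixed base-point $b\in X$. Let $(z_n)_{n\in\mathbb{N}}$ be a sequence in $X$ and let $\xi\in X(\infty)$ be a point of the horofunction boundary of $(X,d)$. Then $z_n$ converges to $\xi$ (that is, the functions $\psi_{z_n}$ converge to $\xi$ in $C(X)$) if and only if, for each $\alpha\in\mathbb{R}$, the sequence of balls $B(z_n, d(b,z_n)+\alpha)$ converges, as $n\to\infty$, to the sublevel set $\operatorname{slv}(\xi,\alpha)$ in the Painlevé–Kuratowski topology.
   Context: Non-reversible metric: $d:X\times X\to[0,\infty)$ satisfies all the axioms of a metric except possibly symmetry ($d(x,y)=0$ iff $x=y$, and $d(x,z)\le d(x,y)+d(y,z)$). Set $d_{\mathrm{sym}}(x,y):=d(x,y)+d(y,x)$; $X$ carries the topology of the metric $d_{\mathrm{sym}}$. A geodesic in $(X,d)$ is a map $\gamma$ from a closed interval of $\mathbb{R}$ to $X$ with $d(\gamma(s),\gamma(t))=t-s$ for all $s<t$ in the interval; a geodesic from $x$ to $y$ starts at $x$ and ends at $y$. Assumptions: (I) $d_{\mathrm{sym}}$ is proper, i.e. its closed balls are compact; (II) for any two given points $x,y\in X$ there is a geodesic in $(X,d)$ from $x$ to $y$; (III) for any point $x$ and sequence $(x_n)$ in $X$, $d(x_n,x)\to0$ if and only if $d(x,x_n)\to0$. Horofunction boundary: fix a base-point $b\in X$. For $z\in X$ let $\psi_z:X\to\mathbb{R}$, $\psi_z(x):=d(x,z)-d(b,z)$. Let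 $C(X)$ be the space of continuous real-valued functions on $X$ with the topology of uniform convergence on bounded sets of $d_{\mathrm{sym}}$. The map $\psi:z\mapsto\psi_z$ is injective and continuous (and, under (I)–(III), an embedding, so $X$ is identified with its image). The horofunction boundary is $X(\infty):=(\operatorname{cl}\psi(X))\setminus\psi(X)$, the closure being taken in $C(X)$; its elements are the horofunctions. Sublevel sets and balls: for $f:X\to\mathbb{R}$ and $\alpha\in\mathbb{R}$, $\operatorname{slv}(f,\alpha):=\{x\in X\mid f(x)\le\alpha\}$. For $z\in X$ and $\alpha\in\mathbb{R}$, $B(z,\alpha):=\{x\in X\mid d(x,z)\le\alpha\}$ (right closed ball). Painlevé–Kuratowski convergence: for a sequence $(C_n)_{n\in\mathbb{N}}$ of closed subsets of $X$, let $\operatorname{Ls}C_n:=\bigcap_{n\ge0}\operatorname{cl}\big(\bigcup_{i>n}C_i\big)$ and $\operatorname{Li}C_n:=\bigcap\big(\operatorname{cl}\bigcup_{i\ge0}C_{n_i}\mid (n_i)_{i\in\mathbb{N}}\text{ an increasing sequence in }\mathbb{N}\big)$. The sequence converges to a closed set $C$ if $\operatorname{Ls}C_n=\operatorname{Li}C_n=C$. *)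

theory Defs
  imports "HOL-Analysis.Analysis"
begin

locale nonreversible_metric =
  fixes d :: "'a \<Rightarrow> 'a \<Rightarrow> real"
  assumes nonneg: "0 \<le> d x y"
    and zero_iff: "d x y = 0 \<longleftrightarrow> x = y"
    and triangle: "d x z \<le> d x y + d y z"

definition dsym :: "('a \<Rightarrow> 'a \<Rightarrow> real) \<Rightarrow> 'a \<Rightarrow> 'a \<Rightarrow> real" where
  "dsym d x y = d x y + d y x"

lemma (in nonreversible_metric) Metric_space_dsym: "Metric_space UNIV (dsym d)"
proof
  fix x y z
  show "0 \<le> dsym d x y" by (simp add: dsym_def nonneg)
  show "dsym d x y = dsym d y x" by (simp add: dsym_def)
  show "dsym d x y = 0 \<longleftrightarrow> x = y"
    using nonneg[of x y] nonneg[of y x] zero_iff[of x y] zero_iff[of y x]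
    by (auto simp: dsym_def)
  show "dsym d x z \<le> dsym d x y + dsym d y z"
    using triangle[of x z y] triangle[of z x y] by (simp add: dsym_def)
qed

abbreviation sym_topology :: "('a \<Rightarrow> 'a \<Rightarrow> real) \<Rightarrow> 'a topology" where
  "sym_topology d \<equiv> Metric_space.mtopology UNIV (dsym d)"

definition sym_proper :: "('a \<Rightarrow> 'a \<Rightarrow> real) \<Rightarrow> bool" where
  "sym_proper d \<longleftrightarrow>
     (\<forall>x r. compactin (sym_topology d) (Metric_space.mcball UNIV (dsym d) x r))"

text \<open>Only the values of \<open>\<gamma>\<close> on \<open>{s0..s1}\<close> matter; the interval may be a single point.\<close>

definition geodesic_on :: "('a \<Rightarrow> 'a \<Rightarrow> real) \<Rightarrow> real \<Rightarrow> real \<Rightarrow> (real \<Rightarrow> 'a) \<Rightarrow> bool" where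
  "geodesic_on d s0 s1 \<gamma> \<longleftrightarrow>
     s0 \<le> s1 \<and> (\<forall>s\<in>{s0..s1}. \<forall>t\<in>{s0..s1}. s < t \<longrightarrow> d (\<gamma> s) (\<gamma> t) = t - s)"

definition is_geodesic_space :: "('a \<Rightarrow> 'a \<Rightarrow> real) \<Rightarrow> bool" where
  "is_geodesic_space d \<longleftrightarrow>
     (\<forall>x y. \<exists>s0 s1 \<gamma>. geodesic_on d s0 s1 \<gamma> \<and> \<gamma> s0 = x \<and> \<gamma> s1 = y)"

definition forward_backward_null :: "('a \<Rightarrow> 'a \<Rightarrow> real) \<Rightarrow> bool" where
  "forward_backward_null d \<longleftrightarrow>
     (\<forall>x (u :: nat \<Rightarrow> 'a). (\<lambda>n. d (u n) x) \<longlonglongrightarrow> 0 \<longleftrightarrow> (\<lambda>n. d x (u n)) \<longlonglongrightarrow> 0)"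

definition cont_funs :: "('a \<Rightarrow> 'a \<Rightarrow> real) \<Rightarrow> ('a \<Rightarrow> real) set" where
  "cont_funs d = {f. continuous_map (sym_topology d) euclideanreal f}"

text \<open>The space \<open>C(X)\<close> with the topology of uniform convergence on bounded sets of \<open>dsym d\<close>.\<close>

definition ucb_open :: "('a \<Rightarrow> 'a \<Rightarrow> real) \<Rightarrow> ('a \<Rightarrow> real) set \<Rightarrow> bool" where
  "ucb_open d U \<longleftrightarrow> U \<subseteq> cont_funs d \<and>
     (\<forall>f\<in>U. \<exists>S \<epsilon>. Metric_space.mbounded UNIV (dsym d) S \<and> \<epsilon> > 0 \<and>
        {g \<in> cont_funs d. \<forall>x\<in>S. \<bar>g x - f x\<bar> < \<epsilon>} \<subseteq> U)"

definition C_topology :: "('a \<Rightarrow> 'a \<Rightarrow> real) \<Rightarrow> ('a \<Rightarrow> real) topology" where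
  "C_topology d = topology (ucb_open d)"

lemma (in nonreversible_metric) openin_C_topology: "openin (C_topology d) = ucb_open d"
proof -
  interpret Sym: Metric_space UNIV "dsym d" by (rule Metric_space_dsym)
  have "istopology (ucb_open d)"
    unfolding istopology_def
  proof (intro conjI allI impI)
    fix U V assume U: "ucb_open d U" and V: "ucb_open d V"
    show "ucb_open d (U \<inter> V)"
      unfolding ucb_open_def
    proof (intro conjI ballI)
      show "U \<inter> V \<subseteq> cont_funs d" using U by (auto simp: ucb_open_def)
      fix f assume f: "f \<in> U \<inter> V"
      obtain S e where S: "Sym.mbounded S" "e > 0"
          "{g \<in> cont_funs d. \<forall>x\<in>S. \<bar>g x - f x\<bar> < e} \<subseteq> U"
        using U f unfolding ucb_open_def by blast
      obtain T e' where T: "Sym.mbounded T" "e' > 0"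
          "{g \<in> cont_funs d. \<forall>x\<in>T. \<bar>g x - f x\<bar> < e'} \<subseteq> V"
        using V f unfolding ucb_open_def by blast
      have "{g \<in> cont_funs d. \<forall>x\<in>S \<union> T. \<bar>g x - f x\<bar> < min e e'} \<subseteq> U \<inter> V"
        using S(3) T(3) by auto
      moreover have "Sym.mbounded (S \<union> T)" "min e e' > 0"
        using S T by (auto simp: Sym.mbounded_Un)
      ultimately show "\<exists>S \<epsilon>. Sym.mbounded S \<and> \<epsilon> > 0 \<and>
          {g \<in> cont_funs d. \<forall>x\<in>S. \<bar>g x - f x\<bar> < \<epsilon>} \<subseteq> U \<inter> V"
        by blast
    qed
  next
    fix K assume K: "\<forall>U\<in>K. ucb_open d U"
    show "ucb_open d (\<Union>K)"
      unfolding ucb_open_def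
    proof (intro conjI ballI)
      show "\<Union>K \<subseteq> cont_funs d" using K by (auto simp: ucb_open_def)
      fix f assume "f \<in> \<Union>K"
      then obtain U where U: "U \<in> K" "f \<in> U" by blast
      then obtain S e where "Sym.mbounded S" "e > 0"
          "{g \<in> cont_funs d. \<forall>x\<in>S. \<bar>g x - f x\<bar> < e} \<subseteq> U"
        using K unfolding ucb_open_def by blast
      then show "\<exists>S \<epsilon>. Sym.mbounded S \<and> \<epsilon> > 0 \<and>
          {g \<in> cont_funs d. \<forall>x\<in>S. \<bar>g x - f x\<bar> < \<epsilon>} \<subseteq> \<Union>K"
        using U(1) by blast
    qed
  qed
  then show ?thesis by (simp add: C_topology_def)
qed

lemma (in nonreversible_metric) topspace_C_topology: "topspace (C_topology d) = cont_funs d"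
proof
  show "topspace (C_topology d) \<subseteq> cont_funs d"
    unfolding topspace_def openin_C_topology by (auto simp: ucb_open_def)
  have "Metric_space.mbounded UNIV (dsym d) {}"
    by (simp add: Metric_space.mbounded_empty Metric_space_dsym)
  then have "ucb_open d (cont_funs d)"
    unfolding ucb_open_def by (intro conjI ballI exI[of _ "{}"] exI[of _ 1]) auto
  then show "cont_funs d \<subseteq> topspace (C_topology d)"
    unfolding topspace_def openin_C_topology by blast
qed

definition psi :: "('a \<Rightarrow> 'a \<Rightarrow> real) \<Rightarrow> 'a \<Rightarrow> 'a \<Rightarrow> 'a \<Rightarrow> real" where
  "psi d b z = (\<lambda>x. d x z - d b z)"

definition horofunction_boundary :: "('a \<Rightarrow> 'a \<Rightarrow> real) \<Rightarrow> 'a \<Rightarrow> ('a \<Rightarrow> real) set" where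
  "horofunction_boundary d b = (C_topology d closure_of range (psi d b)) - range (psi d b)"

definition slv :: "('a \<Rightarrow> real) \<Rightarrow> real \<Rightarrow> 'a set" where
  "slv f \<alpha> = {x. f x \<le> \<alpha>}"

definition right_ball :: "('a \<Rightarrow> 'a \<Rightarrow> real) \<Rightarrow> 'a \<Rightarrow> real \<Rightarrow> 'a set" where
  "right_ball d z \<alpha> = {x. d x z \<le> \<alpha>}"

definition PK_Ls :: "'a topology \<Rightarrow> (nat \<Rightarrow> 'a set) \<Rightarrow> 'a set" where
  "PK_Ls T C = (\<Inter>n. T closure_of (\<Union>i\<in>{n<..}. C i))"

definition PK_Li :: "'a topology \<Rightarrow> (nat \<Rightarrow> 'a set) \<Rightarrow> 'a set" where
  "PK_Li T C = (\<Inter>r\<in>{r :: nat \<Rightarrow> nat. strict_mono r}. T closure_of (\<Union>i. C (r i)))"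

text \<open>Used for sequences of closed sets; the limit is then closed automatically,
  since \<open>PK_Ls T C\<close> is an intersection of closures.\<close>

definition PK_converges :: "'a topology \<Rightarrow> (nat \<Rightarrow> 'a set) \<Rightarrow> 'a set \<Rightarrow> bool" where
  "PK_converges T C L \<longleftrightarrow> PK_Ls T C = L \<and> PK_Li T C = L"

end

theory Submission
  imports Defs
begin

text \<open>
  The balls in question are sublevel sets: \<open>B(z, d(b,z) + \<alpha>) = slv(\<psi>\<^sub>z, \<alpha>)\<close>. All functions
  \<open>\<psi>\<^sub>z\<close>, and hence their limits, satisfy \<open>f x - f y \<le> d x y\<close> and are therefore 1-Lipschitz for
  the symmetrised metric. For such functions both kinds of convergence are the same as pointwise
  convergence.

  For convergence in \<open>C(X)\<close> this is equicontinuity: bounded sets are totally bounded by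
  properness, so a finite net controls the whole set (\<open>pointwise_imp_limitin_C_topology\<close>).

  For Painleve-Kuratowski convergence of sublevel sets, the sequential description of upper and
  lower limits shows that convergence of the sublevel sets pins down every value: the upper limit
  bounds \<open>f\<^sub>n x\<close> from below and the lower limit bounds it from above. In the other direction
  the upper limit causes no difficulty, but a point with \<open>g x = \<alpha>\<close> may be missed by the lower
  limit unless it can be approached by points where \<open>g < \<alpha>\<close>. The limit function is therefore
  required to have no local minimum (\<open>PK_converges_slv_iff_pointwise\<close>).

  Horofunctions have no local minimum (\<open>horofunction_no_local_min\<close>), and this is where the three
  assumptions on the space meet. By properness, functions \<open>\<psi>\<^sub>w\<close> close to a horofunction have \<open>w\<close>
  far away, as otherwise an accumulation point \<open>l\<close> of such \<open>w\<close> would give \<open>\<xi> = \<psi>\<^sub>l\<close>. Moving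
  from \<open>x\<close> a small distance \<open>\<delta>\<close> along a geodesic to \<open>w\<close> lowers \<open>\<psi>\<^sub>w\<close> by exactly \<open>\<delta>\<close>, hence lowers
  \<open>\<xi>\<close>; and by the third assumption the point reached is close to \<open>x\<close> also for the symmetrised
  metric.
\<close>

section \<open>Painleve-Kuratowski limits in metric spaces\<close>

context Metric_space
begin

lemma PK_Ls_iff_frequently:
  "x \<in> PK_Ls mtopology C \<longleftrightarrow> x \<in> M \<and> (\<forall>\<epsilon>>0. \<exists>\<^sub>F n in sequentially. \<exists>y\<in>C n. y \<in> mball x \<epsilon>)"
proof -
  have freq: "(\<forall>n. \<exists>i>n. P i) \<longleftrightarrow> (\<exists>\<^sub>F n in sequentially. P n)" for P :: "nat \<Rightarrow> bool"
    by (simp add: INFM_nat cofinite_eq_sequentially[symmetric])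
  have Un: "(\<exists>y\<in>\<Union>i\<in>{n<..}. C i. y \<in> B) \<longleftrightarrow> (\<exists>i>n. \<exists>y\<in>C i. y \<in> B)" for n B
    by blast
  have "x \<in> PK_Ls mtopology C \<longleftrightarrow> x \<in> M \<and> (\<forall>\<epsilon>>0. \<forall>n. \<exists>i>n. \<exists>y\<in>C i. y \<in> mball x \<epsilon>)"
    unfolding PK_Ls_def metric_closure_of Un by blast
  then show ?thesis unfolding freq .
qed

text \<open>If the sets \<open>C n\<close> missed a ball around \<open>x\<close> infinitely often, the indices where they do
  would form a subsequence whose union does not accumulate at \<open>x\<close>.\<close>

lemma PK_Li_iff_eventually:
  "x \<in> PK_Li mtopology C \<longleftrightarrow> x \<in> M \<and> (\<forall>\<epsilon>>0. \<forall>\<^sub>F n in sequentially. \<exists>y\<in>C n. y \<in> mball x \<epsilon>)"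
  (is "?L \<longleftrightarrow> ?R")
proof
  assume L: ?L
  then have cl: "x \<in> mtopology closure_of (\<Union>i. C (r i))" if "strict_mono r" for r :: "nat \<Rightarrow> nat"
    using that unfolding PK_Li_def by blast
  have "\<forall>\<^sub>F n in sequentially. \<exists>y\<in>C n. y \<in> mball x \<epsilon>" if "\<epsilon> > 0" for \<epsilon>
  proof (rule ccontr)
    assume "\<not> ?thesis"
    from not_eventually_sequentiallyD[OF this] obtain r :: "nat \<Rightarrow> nat"
      where r: "strict_mono r" "\<And>n. \<not> (\<exists>y\<in>C (r n). y \<in> mball x \<epsilon>)" by blast
    show False
      using cl[OF r(1)] r(2) \<open>\<epsilon> > 0\<close> unfolding metric_closure_of by blast
  qed
  moreover have "x \<in> M"
    using cl[OF strict_mono_id] unfolding metric_closure_of by blast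
  ultimately show ?R by blast
next
  assume R: ?R
  show ?L
    unfolding PK_Li_def metric_closure_of
  proof (intro INT_I CollectI conjI allI impI)
    show "x \<in> M" using R by blast
    fix r :: "nat \<Rightarrow> nat" and \<epsilon> :: real
    assume "r \<in> {r. strict_mono r}" "0 < \<epsilon>"
    then have "\<forall>\<^sub>F n in sequentially. \<exists>y\<in>C (r n). y \<in> mball x \<epsilon>"
      using R by (intro eventually_subseq[of r "\<lambda>n. \<exists>y\<in>C n. y \<in> mball x \<epsilon>"]) (blast+)
    then show "\<exists>y\<in>\<Union>i. C (r i). y \<in> mball x \<epsilon>"
      unfolding eventually_sequentially by blast
  qed
qed

lemma PK_Li_subset_Ls: "PK_Li mtopology C \<subseteq> PK_Ls mtopology C"
  unfolding PK_Ls_iff_frequently PK_Li_iff_eventually subset_iff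
  using eventually_frequently[OF sequentially_bot] by blast

end

context nonreversible_metric
begin

interpretation Sym: Metric_space UNIV "dsym d"
  by (rule Metric_space_dsym)

section \<open>Functions that are short for the non-reversible metric\<close>

text \<open>The non-expansive functions, for the asymmetric distance \<open>max 0 (s - t)\<close> on the real line.\<close>

definition short :: "('a \<Rightarrow> real) \<Rightarrow> bool" where
  "short f \<longleftrightarrow> (\<forall>x y. f x - f y \<le> d x y)"

lemma short_abs_le_dsym:
  assumes "short f"
  shows "\<bar>f x - f y\<bar> \<le> dsym d x y"
proof -
  have "f x - f y \<le> d x y" "f y - f x \<le> d y x"
    using assms by (auto simp: short_def)
  then show ?thesis
    using nonneg[of x y] nonneg[of y x] by (simp add: dsym_def)
qed

lemma short_psi: "short (psi d b z)"
  unfolding short_def psi_def using triangle by (simp add: algebra_simps)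

lemma short_cont_funs:
  assumes "short f"
  shows "f \<in> cont_funs d"
proof -
  have "openin (sym_topology d) {x. f x \<in> U}" if "open U" for U
    unfolding Sym.openin_mtopology
  proof (intro conjI allI impI)
    fix x assume "x \<in> {x. f x \<in> U}"
    with \<open>open U\<close> obtain e where e: "e > 0" "\<And>t. \<bar>t - f x\<bar> < e \<Longrightarrow> t \<in> U"
      by (auto simp: open_dist dist_real_def)
    have "Sym.mball x e \<subseteq> {x. f x \<in> U}"
    proof
      fix y assume "y \<in> Sym.mball x e"
      then have "dsym d y x < e" by (simp add: Sym.commute)
      then show "y \<in> {x. f x \<in> U}"
        using short_abs_le_dsym[OF assms, of y x] e(2) by auto
    qed
    then show "\<exists>r>0. Sym.mball x r \<subseteq> {x. f x \<in> U}" using e(1) by blast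
  qed simp
  then show ?thesis
    by (simp add: cont_funs_def continuous_map_def)
qed

lemma psi_dist_le: "\<bar>psi d b w x - psi d b l x\<bar> \<le> 2 * dsym d w l"
proof -
  have "\<bar>d y w - d y l\<bar> \<le> dsym d w l" for y
    using triangle[of y w l] triangle[of y l w] nonneg[of w l] nonneg[of l w]
    by (simp add: dsym_def)
  from this[of x] this[of b] show ?thesis by (simp add: psi_def)
qed

section \<open>The topology of uniform convergence on bounded sets\<close>

text \<open>The set of all \<open>g\<close> with \<open>\<bar>g - f\<bar> < \<epsilon>\<close> pointwise on \<open>S\<close> need not be open, because the supremum
  over \<open>S\<close> may equal \<open>\<epsilon>\<close>. Requiring a uniform bound below \<open>\<epsilon>\<close> repairs this.\<close>

lemma openin_uniform_ball:
  assumes S: "Sym.mbounded S"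
  shows "openin (C_topology d) {g \<in> cont_funs d. \<exists>e<\<epsilon>. \<forall>x\<in>S. \<bar>g x - f x\<bar> \<le> e}"
    (is "openin _ ?U")
proof -
  have "\<exists>S' \<epsilon>'. Sym.mbounded S' \<and> \<epsilon>' > 0 \<and> {h \<in> cont_funs d. \<forall>x\<in>S'. \<bar>h x - g x\<bar> < \<epsilon>'} \<subseteq> ?U"
    if "g \<in> ?U" for g
  proof -
    from that obtain e where e: "e < \<epsilon>" "\<And>x. x \<in> S \<Longrightarrow> \<bar>g x - f x\<bar> \<le> e" by blast
    have "h \<in> ?U" if h: "h \<in> cont_funs d" "\<forall>x\<in>S. \<bar>h x - g x\<bar> < (\<epsilon> - e) / 2" for h
    proof -
      have "\<bar>h x - f x\<bar> \<le> (\<epsilon> + e) / 2" if "x \<in> S" for x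
      proof -
        have "\<bar>h x - f x\<bar> \<le> \<bar>h x - g x\<bar> + \<bar>g x - f x\<bar>" by simp
        also have "\<dots> \<le> (\<epsilon> - e) / 2 + e"
          using h(2) e(2) that by (intro add_mono) force+
        finally show ?thesis by (simp add: field_simps)
      qed
      moreover have "(\<epsilon> + e) / 2 < \<epsilon>" using e(1) by simp
      ultimately show ?thesis using h(1) by blast
    qed
    moreover have "(\<epsilon> - e) / 2 > 0" using e(1) by simp
    ultimately show ?thesis using S by blast
  qed
  then show ?thesis
    unfolding openin_C_topology ucb_open_def by blast
qed

lemma self_in_uniform_ball:
  assumes "f \<in> cont_funs d" "(0::real) < \<epsilon>"
  shows "f \<in> {g \<in> cont_funs d. \<exists>e<\<epsilon>. \<forall>x\<in>S. \<bar>g x - f x\<bar> \<le> e}"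
  using assms by auto

lemma limitin_C_topology:
  "limitin (C_topology d) f g F \<longleftrightarrow>
     g \<in> cont_funs d \<and> (\<forall>\<^sub>F n in F. f n \<in> cont_funs d) \<and>
     (\<forall>S \<epsilon>. Sym.mbounded S \<longrightarrow> \<epsilon> > 0 \<longrightarrow> (\<forall>\<^sub>F n in F. \<forall>x\<in>S. \<bar>f n x - g x\<bar> < \<epsilon>))"
  (is "?L \<longleftrightarrow> ?R")
proof
  assume L: ?L
  then have g: "g \<in> cont_funs d"
    and ev: "\<And>U. openin (C_topology d) U \<Longrightarrow> g \<in> U \<Longrightarrow> \<forall>\<^sub>F n in F. f n \<in> U"
    by (auto simp: limitin_def topspace_C_topology)
  have "\<forall>\<^sub>F n in F. f n \<in> cont_funs d"
    using ev[OF openin_topspace] g by (simp add: topspace_C_topology)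
  moreover have "\<forall>\<^sub>F n in F. \<forall>x\<in>S. \<bar>f n x - g x\<bar> < \<epsilon>" if "Sym.mbounded S" "\<epsilon> > 0" for S \<epsilon>
    using ev[OF openin_uniform_ball[OF that(1)] self_in_uniform_ball[OF g that(2)]]
    by (rule eventually_mono) force
  ultimately show ?R using g by blast
next
  assume R: ?R
  show ?L
    unfolding limitin_def topspace_C_topology
  proof (intro conjI allI impI)
    show "g \<in> cont_funs d" using R by blast
    fix U assume "openin (C_topology d) U \<and> g \<in> U"
    then obtain S \<epsilon> where S: "Sym.mbounded S" "\<epsilon> > 0"
        "{h \<in> cont_funs d. \<forall>x\<in>S. \<bar>h x - g x\<bar> < \<epsilon>} \<subseteq> U"
      unfolding openin_C_topology ucb_open_def by blast
    have "\<forall>\<^sub>F n in F. f n \<in> cont_funs d \<and> (\<forall>x\<in>S. \<bar>f n x - g x\<bar> < \<epsilon>)"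
      using R S(1,2) by (simp add: eventually_conj)
    then show "\<forall>\<^sub>F n in F. f n \<in> U"
      by (rule eventually_mono) (use S(3) in blast)
  qed
qed

lemma closure_of_C_topologyD:
  assumes "g \<in> C_topology d closure_of A" "Sym.mbounded S" "0 < \<epsilon>"
  obtains f where "f \<in> A" "\<And>x. x \<in> S \<Longrightarrow> \<bar>f x - g x\<bar> < \<epsilon>"
proof -
  have g: "g \<in> cont_funs d"
    using assms(1) by (simp add: in_closure_of topspace_C_topology)
  let ?U = "{h \<in> cont_funs d. \<exists>e<\<epsilon>. \<forall>x\<in>S. \<bar>h x - g x\<bar> \<le> e}"
  have "g \<in> ?U \<and> openin (C_topology d) ?U"
    using self_in_uniform_ball[OF g assms(3)] openin_uniform_ball[OF assms(2)] by (rule conjI)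
  then have "\<exists>f. f \<in> A \<and> f \<in> ?U"
    using assms(1)[unfolded in_closure_of, THEN conjunct2, THEN spec] by (rule rev_mp)
  then obtain f e where "f \<in> A" "e < \<epsilon>" "\<And>x. x \<in> S \<Longrightarrow> \<bar>f x - g x\<bar> \<le> e" by blast
  then show thesis using that[of f] by (meson le_less_trans)
qed

lemma short_closure_of:
  assumes g: "g \<in> C_topology d closure_of A" and A: "\<And>f. f \<in> A \<Longrightarrow> short f"
  shows "short g"
  unfolding short_def
proof (intro allI)
  fix x y
  show "g x - g y \<le> d x y"
  proof (rule field_le_epsilon)
    fix e :: real assume "0 < e"
    then have "0 < e / 2" by simp
    moreover have "Sym.mbounded {x, y}"
      by (simp add: Sym.mbounded_insert)
    ultimately obtain f where f: "f \<in> A" "\<And>u. u \<in> {x, y} \<Longrightarrow> \<bar>f u - g u\<bar> < e / 2"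
      using closure_of_C_topologyD[OF g] by blast
    have "f x - f y \<le> d x y" using A[OF f(1)] by (simp add: short_def)
    moreover have "\<bar>f x - g x\<bar> < e / 2" "\<bar>f y - g y\<bar> < e / 2" using f(2) by auto
    ultimately show "g x - g y \<le> d x y + e"
      by linarith
  qed
qed

lemma pointwise_imp_limitin_C_topology:
  assumes proper: "sym_proper d"
    and f: "\<And>n. short (f n)" and g: "short g"
    and lim: "\<And>x. ((\<lambda>n. f n x) \<longlongrightarrow> g x) F"
  shows "limitin (C_topology d) f g F"
  unfolding limitin_C_topology
proof (intro conjI allI impI)
  show "g \<in> cont_funs d" using g by (rule short_cont_funs)
  show "\<forall>\<^sub>F n in F. f n \<in> cont_funs d" by (simp add: f short_cont_funs)
  fix S and \<epsilon> :: real
  assume "Sym.mbounded S" and \<epsilon>: "0 < \<epsilon>"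
  then obtain c r where S: "S \<subseteq> Sym.mcball c r"
    by (auto simp: Sym.mbounded_def)
  have "Sym.mtotally_bounded (Sym.mcball c r)"
    using proper by (intro Sym.compactin_imp_mtotally_bounded) (simp add: sym_proper_def)
  moreover have "0 < \<epsilon> / 3" using \<epsilon> by simp
  ultimately obtain K where K: "finite K" "Sym.mcball c r \<subseteq> (\<Union>k\<in>K. Sym.mball k (\<epsilon> / 3))"
    unfolding Sym.mtotally_bounded_def by meson
  have "\<forall>\<^sub>F n in F. \<bar>f n k - g k\<bar> < \<epsilon> / 3" for k
    using tendstoD[OF lim \<open>0 < \<epsilon> / 3\<close>] by (simp only: dist_real_def)
  then have "\<forall>\<^sub>F n in F. \<forall>k\<in>K. \<bar>f n k - g k\<bar> < \<epsilon> / 3"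
    using K(1) by (intro eventually_ball_finite) blast+
  then show "\<forall>\<^sub>F n in F. \<forall>x\<in>S. \<bar>f n x - g x\<bar> < \<epsilon>"
  proof (rule eventually_mono, intro ballI)
    fix n x assume n: "\<forall>k\<in>K. \<bar>f n k - g k\<bar> < \<epsilon> / 3" and "x \<in> S"
    then obtain k where k: "k \<in> K" "dsym d k x < \<epsilon> / 3" using S K(2) by force
    have "\<bar>f n k - g k\<bar> < \<epsilon> / 3" using n k(1) by blast
    with k(2) short_abs_le_dsym[OF f, of n k x] short_abs_le_dsym[OF g, of k x]
    show "\<bar>f n x - g x\<bar> < \<epsilon>" by linarith
  qed
qed

lemma limitin_C_topology_iff_pointwise:
  assumes "sym_proper d" "\<And>n. short (f n)" "short g"
  shows "limitin (C_topology d) f g F \<longleftrightarrow> (\<forall>x. ((\<lambda>n. f n x) \<longlongrightarrow> g x) F)"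
proof
  assume L: "limitin (C_topology d) f g F"
  show "\<forall>x. ((\<lambda>n. f n x) \<longlongrightarrow> g x) F"
  proof
    fix x
    have "Sym.mbounded {x}" by (simp add: Sym.mbounded_insert)
    with L have "\<forall>\<^sub>F n in F. \<forall>u\<in>{x}. \<bar>f n u - g u\<bar> < \<epsilon>" if "\<epsilon> > 0" for \<epsilon>
      using that unfolding limitin_C_topology by blast
    then show "((\<lambda>n. f n x) \<longlongrightarrow> g x) F"
      by (simp add: tendsto_iff dist_real_def)
  qed
next
  assume "\<forall>x. ((\<lambda>n. f n x) \<longlongrightarrow> g x) F"
  then show "limitin (C_topology d) f g F"
    using pointwise_imp_limitin_C_topology assms by blast
qed

section \<open>Convergence of sublevel sets of short functions\<close>

lemma right_ball_eq_slv_psi: "right_ball d z (d b z + \<alpha>) = slv (psi d b z) \<alpha>"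
  by (auto simp: right_ball_def slv_def psi_def)

lemma PK_converges_slv_imp_pointwise:
  assumes f: "\<And>n. short (f n)"
    and PK: "\<And>\<alpha>. PK_converges (sym_topology d) (\<lambda>n. slv (f n) \<alpha>) (slv g \<alpha>)"
  shows "(\<lambda>n. f n x) \<longlonglongrightarrow> g x"
proof (rule order_tendstoI)
  fix a assume "a < g x"
  show "\<forall>\<^sub>F n in sequentially. a < f n x"
  proof (rule ccontr)
    assume "\<not> ?thesis"
    then have fr: "\<exists>\<^sub>F n in sequentially. f n x \<le> a"
      by (simp add: not_eventually not_less)
    have "x \<in> PK_Ls (sym_topology d) (\<lambda>n. slv (f n) a)"
      unfolding Sym.PK_Ls_iff_frequently
    proof (intro conjI allI impI)
      fix \<epsilon> :: real assume "0 < \<epsilon>"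
      show "\<exists>\<^sub>F n in sequentially. \<exists>y\<in>slv (f n) a. y \<in> Sym.mball x \<epsilon>"
        by (rule frequently_elim1[OF fr]) (use \<open>0 < \<epsilon>\<close> in \<open>auto simp: slv_def\<close>)
    qed simp
    then have "x \<in> slv g a" using PK by (simp add: PK_converges_def)
    with \<open>a < g x\<close> show False by (simp add: slv_def)
  qed
next
  fix a assume a: "g x < a"
  have "x \<in> PK_Li (sym_topology d) (\<lambda>n. slv (f n) (g x))"
    using PK by (simp add: PK_converges_def slv_def)
  then have "\<forall>\<^sub>F n in sequentially. \<exists>y\<in>slv (f n) (g x). y \<in> Sym.mball x (a - g x)"
    using a by (simp add: Sym.PK_Li_iff_eventually)
  then show "\<forall>\<^sub>F n in sequentially. f n x < a"
  proof (rule eventually_mono)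
    fix n assume "\<exists>y\<in>slv (f n) (g x). y \<in> Sym.mball x (a - g x)"
    then obtain y where "f n y \<le> g x" "dsym d x y < a - g x" by (auto simp: slv_def)
    with short_abs_le_dsym[OF f, of n x y] show "f n x < a" by linarith
  qed
qed

text \<open>Without the condition on local minima the sublevel set of \<open>g\<close> at a local minimum value could
  contain a point isolated from all sublevel sets of the \<open>f n\<close>, if these approach \<open>g\<close> from above.\<close>

lemma pointwise_imp_PK_converges_slv:
  assumes f: "\<And>n. short (f n)"
    and no_local_min: "\<And>x \<epsilon>. 0 < \<epsilon> \<Longrightarrow> \<exists>y. dsym d x y < \<epsilon> \<and> g y < g x"
    and lim: "\<And>x. (\<lambda>n. f n x) \<longlonglongrightarrow> g x"
  shows "PK_converges (sym_topology d) (\<lambda>n. slv (f n) \<alpha>) (slv g \<alpha>)"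
proof -
  have "PK_Ls (sym_topology d) (\<lambda>n. slv (f n) \<alpha>) \<subseteq> slv g \<alpha>"
  proof
    fix x assume x: "x \<in> PK_Ls (sym_topology d) (\<lambda>n. slv (f n) \<alpha>)"
    have "g x \<le> \<alpha> + e" if "0 < e" for e
    proof -
      have "0 < e / 2" using that by simp
      then have "\<exists>\<^sub>F n in sequentially. \<exists>y\<in>slv (f n) \<alpha>. y \<in> Sym.mball x (e / 2)"
        using x unfolding Sym.PK_Ls_iff_frequently by blast
      moreover have "\<forall>\<^sub>F n in sequentially. g x - e / 2 < f n x"
        using lim[of x] by (rule order_tendstoD) (use that in simp)
      ultimately have "\<exists>\<^sub>F n in sequentially.
          (\<exists>y\<in>slv (f n) \<alpha>. y \<in> Sym.mball x (e / 2)) \<and> g x - e / 2 < f n x"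
        by (rule frequently_eventually_frequently)
      then obtain n y where "f n y \<le> \<alpha>" "dsym d x y < e / 2" "g x - e / 2 < f n x"
        by (auto dest!: frequently_ex simp: slv_def)
      with short_abs_le_dsym[OF f, of n x y] show ?thesis by linarith
    qed
    then show "x \<in> slv g \<alpha>" by (simp add: slv_def field_le_epsilon)
  qed
  moreover have "slv g \<alpha> \<subseteq> PK_Li (sym_topology d) (\<lambda>n. slv (f n) \<alpha>)"
  proof
    fix x assume x: "x \<in> slv g \<alpha>"
    show "x \<in> PK_Li (sym_topology d) (\<lambda>n. slv (f n) \<alpha>)"
      unfolding Sym.PK_Li_iff_eventually
    proof (intro conjI allI impI)
      fix \<epsilon> :: real assume "0 < \<epsilon>"
      then obtain y where y: "dsym d x y < \<epsilon>" "g y < g x" using no_local_min by blast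
      then have "g y < \<alpha>" using x by (simp add: slv_def)
      with lim[of y] have "\<forall>\<^sub>F n in sequentially. f n y < \<alpha>" by (rule order_tendstoD)
      then show "\<forall>\<^sub>F n in sequentially. \<exists>y\<in>slv (f n) \<alpha>. y \<in> Sym.mball x \<epsilon>"
        by (rule eventually_mono) (use y(1) in \<open>force simp: slv_def\<close>)
    qed simp
  qed
  ultimately show ?thesis
    using Sym.PK_Li_subset_Ls unfolding PK_converges_def by blast
qed

lemma PK_converges_slv_iff_pointwise:
  assumes "\<And>n. short (f n)"
    and "\<And>x \<epsilon>. 0 < \<epsilon> \<Longrightarrow> \<exists>y. dsym d x y < \<epsilon> \<and> g y < g x"
  shows "(\<forall>\<alpha>. PK_converges (sym_topology d) (\<lambda>n. slv (f n) \<alpha>) (slv g \<alpha>)) \<longleftrightarrow>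
     (\<forall>x. (\<lambda>n. f n x) \<longlonglongrightarrow> g x)"
  using PK_converges_slv_imp_pointwise[of f g] pointwise_imp_PK_converges_slv[of f g] assms
  by blast

section \<open>Horofunctions have no local minimum\<close>

lemma geodesic_point:
  assumes "is_geodesic_space d" "0 < \<delta>" "\<delta> < d x w"
  obtains y where "d x y = \<delta>" "d y w = d x w - \<delta>"
proof -
  obtain s0 s1 \<gamma> where \<gamma>: "geodesic_on d s0 s1 \<gamma>" "\<gamma> s0 = x" "\<gamma> s1 = w"
    using assms(1) unfolding is_geodesic_space_def by blast
  then have *: "\<And>s t. s0 \<le> s \<Longrightarrow> s < t \<Longrightarrow> t \<le> s1 \<Longrightarrow> d (\<gamma> s) (\<gamma> t) = t - s" and "s0 \<le> s1"
    by (auto simp: geodesic_on_def)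
  have "x \<noteq> w" using assms zero_iff[of x w] by auto
  with \<gamma> \<open>s0 \<le> s1\<close> have "s0 < s1" by (cases "s0 = s1") auto
  then have "d x w = s1 - s0" using *[of s0 s1] \<gamma> by simp
  then have "d x (\<gamma> (s0 + \<delta>)) = \<delta>" "d (\<gamma> (s0 + \<delta>)) w = d x w - \<delta>"
    using *[of s0 "s0 + \<delta>"] *[of "s0 + \<delta>" s1] \<gamma> assms by auto
  then show thesis by (rule that)
qed

text \<open>Otherwise there are points \<open>y n\<close> with \<open>d x (y n) \<rightarrow> 0\<close> but \<open>dsym d x (y n) \<ge> \<epsilon>\<close>; the
  hypothesis makes \<open>d (y n) x\<close>, and with it \<open>dsym d x (y n)\<close>, tend to zero.\<close>

lemma small_forward_imp_small_dsym:
  assumes "forward_backward_null d" "0 < \<epsilon>"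
  obtains \<delta> where "0 < \<delta>" "\<And>y. d x y \<le> \<delta> \<Longrightarrow> dsym d x y < \<epsilon>"
proof (rule ccontr)
  assume "\<not> thesis"
  with that have "\<exists>y. d x y \<le> \<delta> \<and> \<epsilon> \<le> dsym d x y" if "0 < \<delta>" for \<delta>
    using \<open>0 < \<delta>\<close> by (meson not_less)
  then have "\<forall>n. \<exists>y. d x y \<le> inverse (real (Suc n)) \<and> \<epsilon> \<le> dsym d x y" by simp
  then obtain y where y: "\<And>n. d x (y n) \<le> inverse (real (Suc n))" "\<And>n. \<epsilon> \<le> dsym d x (y n)"
    by metis
  have fwd: "(\<lambda>n. d x (y n)) \<longlonglongrightarrow> 0"
    by (rule tendsto_sandwich[OF _ _ tendsto_const LIMSEQ_inverse_real_of_nat])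
      (auto intro!: always_eventually y nonneg simp del: of_nat_Suc)
  then have "(\<lambda>n. d (y n) x) \<longlonglongrightarrow> 0"
    using assms(1) by (simp add: forward_backward_null_def)
  with fwd have "(\<lambda>n. dsym d x (y n)) \<longlonglongrightarrow> 0 + 0"
    unfolding dsym_def by (rule tendsto_add)
  then have "\<epsilon> \<le> 0"
    by (intro LIMSEQ_le_const[of "\<lambda>n. dsym d x (y n)" 0 \<epsilon>]) (auto simp: y(2))
  with assms(2) show False by simp
qed

text \<open>If the points of \<open>K\<close> gave arbitrarily good approximations to \<open>\<xi>\<close>, a limit point \<open>l\<close> of such
  approximants in the compact set \<open>K\<close> would satisfy \<open>\<psi>\<^sub>l = \<xi>\<close>.\<close>

lemma compact_psi_away_from:
  assumes K: "compactin (sym_topology d) K" and \<xi>: "\<xi> \<notin> range (psi d b)"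
  obtains S \<epsilon> where "Sym.mbounded S" "0 < \<epsilon>" "\<And>w. w \<in> K \<Longrightarrow> \<exists>x\<in>S. \<epsilon> \<le> \<bar>psi d b w x - \<xi> x\<bar>"
proof (rule ccontr)
  assume contr: "\<not> thesis"
  have "\<exists>w\<in>K. \<forall>x\<in>Sym.mcball b (real n). \<bar>psi d b w x - \<xi> x\<bar> < inverse (real (Suc n))" for n
  proof (rule ccontr)
    assume "\<not> ?thesis"
    then have "\<exists>x\<in>Sym.mcball b (real n). inverse (real (Suc n)) \<le> \<bar>psi d b w x - \<xi> x\<bar>"
      if "w \<in> K" for w
      using \<open>w \<in> K\<close> by (meson not_less)
    then show False
      using contr that[of "Sym.mcball b (real n)" "inverse (real (Suc n))"] Sym.mbounded_mcball by simp
  qed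
  then obtain w where w: "\<And>n. w n \<in> K"
    "\<And>n x. x \<in> Sym.mcball b (real n) \<Longrightarrow> \<bar>psi d b (w n) x - \<xi> x\<bar> < inverse (real (Suc n))"
    by metis
  have "range w \<subseteq> K" using w(1) by blast
  then obtain l and r :: "nat \<Rightarrow> nat" where r: "strict_mono r"
    and l: "limitin (sym_topology d) (w \<circ> r) l sequentially"
    using K unfolding Sym.compactin_sequentially by blast
  have "\<xi> x = psi d b l x" for x
  proof (rule LIMSEQ_unique)
    have "(\<lambda>n. dsym d (w (r n)) l) \<longlonglongrightarrow> 0"
      using l by (simp add: Sym.limitin_metric_dist_null)
    then have "(\<lambda>n. 2 * dsym d (w (r n)) l) \<longlonglongrightarrow> 0"
      using tendsto_mult_right_zero by blast
    then have "(\<lambda>n. psi d b (w (r n)) x - psi d b l x) \<longlonglongrightarrow> 0"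
      by (rule Lim_null_comparison[rotated]) (simp add: psi_dist_le)
    then show "(\<lambda>n. psi d b (w (r n)) x) \<longlonglongrightarrow> psi d b l x"
      by (simp add: LIM_zero_iff)
    have "\<forall>\<^sub>F n in sequentially. \<bar>psi d b (w n) x - \<xi> x\<bar> \<le> inverse (real (Suc n))"
      using eventually_ge_at_top[of "nat \<lceil>dsym d b x\<rceil>"]
    proof (rule eventually_mono)
      fix n assume "nat \<lceil>dsym d b x\<rceil> \<le> n"
      then have "x \<in> Sym.mcball b (real n)" by (simp add: nat_le_iff ceiling_le_iff)
      from w(2)[OF this] show "\<bar>psi d b (w n) x - \<xi> x\<bar> \<le> inverse (real (Suc n))"
        by (rule less_imp_le)
    qed
    then have "(\<lambda>n. psi d b (w n) x - \<xi> x) \<longlonglongrightarrow> 0"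
      by (intro Lim_null_comparison[OF _ LIMSEQ_inverse_real_of_nat]) simp
    then have "(\<lambda>n. psi d b (w n) x) \<longlonglongrightarrow> \<xi> x"
      by (simp add: LIM_zero_iff)
    then show "(\<lambda>n. psi d b (w (r n)) x) \<longlonglongrightarrow> \<xi> x"
      using LIMSEQ_subseq_LIMSEQ[OF _ r] by (fastforce simp: o_def)
  qed
  then have "\<xi> = psi d b l" by blast
  with \<xi> show False by blast
qed

lemma horofunction_no_local_min:
  assumes proper: "sym_proper d" and geod: "is_geodesic_space d"
    and null: "forward_backward_null d"
    and \<xi>: "\<xi> \<in> horofunction_boundary d b" and \<epsilon>: "0 < \<epsilon>"
  shows "\<exists>y. dsym d x y < \<epsilon> \<and> \<xi> y < \<xi> x"
proof -
  have cl: "\<xi> \<in> C_topology d closure_of range (psi d b)" and not: "\<xi> \<notin> range (psi d b)"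
    using \<xi> by (auto simp: horofunction_boundary_def)
  obtain \<delta> where \<delta>: "0 < \<delta>" "\<And>y. d x y \<le> \<delta> \<Longrightarrow> dsym d x y < \<epsilon>"
    using small_forward_imp_small_dsym[OF null \<epsilon>] by blast
  have "compactin (sym_topology d) (Sym.mcball x \<epsilon>)"
    using proper by (simp add: sym_proper_def)
  from compact_psi_away_from[OF this not]
  obtain S \<eta> where S: "Sym.mbounded S" "0 < \<eta>"
    "\<And>w. w \<in> Sym.mcball x \<epsilon> \<Longrightarrow> \<exists>u\<in>S. \<eta> \<le> \<bar>psi d b w u - \<xi> u\<bar>" by blast
  \<comment> \<open>Closeness on \<open>S\<close> keeps \<open>w\<close> out of the ball around \<open>x\<close>; closeness on the ball
    transfers the descent of \<open>\<psi>\<^sub>w\<close> to \<open>\<xi>\<close>, with error at most \<open>\<delta> / 2\<close> at each end.\<close>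
  have "Sym.mbounded (S \<union> Sym.mcball x \<epsilon>)" "0 < min \<eta> (\<delta> / 2)"
    using S(1,2) \<delta>(1) by (auto simp: Sym.mbounded_Un Sym.mbounded_mcball)
  from closure_of_C_topologyD[OF cl this]
  obtain w where w: "\<And>u. u \<in> S \<union> Sym.mcball x \<epsilon> \<Longrightarrow> \<bar>psi d b w u - \<xi> u\<bar> < min \<eta> (\<delta> / 2)"
    by blast
  have "w \<notin> Sym.mcball x \<epsilon>"
    using S(3) w by fastforce
  then have "\<delta> < d x w" using \<delta>(2)[of w] by fastforce
  from geodesic_point[OF geod \<delta>(1) this]
  obtain y where y: "d x y = \<delta>" "d y w = d x w - \<delta>" by blast
  have close: "dsym d x y < \<epsilon>" using y(1) \<delta>(2) by simp
  have "\<bar>psi d b w x - \<xi> x\<bar> < \<delta> / 2" "\<bar>psi d b w y - \<xi> y\<bar> < \<delta> / 2"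
    using w[of x] w[of y] close \<epsilon> by auto
  moreover have "psi d b w y = psi d b w x - \<delta>" using y(2) by (simp add: psi_def)
  ultimately have "\<xi> y < \<xi> x" by linarith
  with close show ?thesis by blast
qed

end

section \<open>Convergence to a horofunction\<close>

theorem proposition2p8:
  fixes d :: "'a \<Rightarrow> 'a \<Rightarrow> real" and b :: 'a and z :: "nat \<Rightarrow> 'a" and \<xi> :: "'a \<Rightarrow> real"
  assumes "nonreversible_metric d"
    and "sym_proper d"
    and "is_geodesic_space d"
    and "forward_backward_null d"
    and "\<xi> \<in> horofunction_boundary d b"
  shows "limitin (C_topology d) (\<lambda>n. psi d b (z n)) \<xi> sequentially \<longleftrightarrow>
    (\<forall>\<alpha>::real. PK_converges (sym_topology d)
       (\<lambda>n. right_ball d (z n) (d b (z n) + \<alpha>)) (slv \<xi> \<alpha>))"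
proof -
  interpret nonreversible_metric d by fact
  have "short \<xi>"
  proof (rule short_closure_of)
    show "\<xi> \<in> C_topology d closure_of range (psi d b)"
      using assms(5) by (simp add: horofunction_boundary_def)
  qed (auto simp: short_psi)
  then have "limitin (C_topology d) (\<lambda>n. psi d b (z n)) \<xi> sequentially \<longleftrightarrow>
      (\<forall>x. (\<lambda>n. psi d b (z n) x) \<longlonglongrightarrow> \<xi> x)"
    by (intro limitin_C_topology_iff_pointwise assms(2) short_psi)
  also have "\<dots> \<longleftrightarrow> (\<forall>\<alpha>. PK_converges (sym_topology d) (\<lambda>n. slv (psi d b (z n)) \<alpha>) (slv \<xi> \<alpha>))"
    by (rule PK_converges_slv_iff_pointwise[symmetric])
      (rule short_psi, rule horofunction_no_local_min[OF assms(2-5)])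
  finally show ?thesis by (simp add: right_ball_eq_slv_psi)
qed

end
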